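(* Let $\Gamma_f=(V,E,f)$ be a balanced weighted Coxeter graph, where $\Gamma=(V,E)$ is the Coxeter graph of a Coxeter system $(W,S)$ with $S$ finite. Then the representation $\mathcal{R}_{\Gamma,f}$ of $W$ is faithful.
   Context: A Coxeter system $(W,S)$ with $S=\{s_1,\dots,s_N\}$ finite is a group $W$ generated by $S$ with defining relations $s_i^2=1$ and $(s_is_j)^{m_{ij}}=1$ for $i\ne j$, where $m_{ij}=m_{ji}\in\{2,3,\dots\}\cup\{\infty\}$ ($m_{ij}=\infty$ means no relation between $s_i$ and $s_j$). Its Coxeter graph $\Gamma=(V,E)$ has vertex set $V=S$, with $s_i,s_j$ ($i\neq j$) joined by an edge exactly when $m_{ij}\ge 3$; edges with $m_{ij}>3$ are labeled by $m_{ij}$. Let $\bar E$ be the set of directed edges: $\{s_i,s_j\}\in E$ if and only if $(s_i,s_j)\in\bar E$ and $(s_j,s_i)\in\bar E$. A legal weight function is a function $f:\bar E\to\mathbb{C}\setminus\{0\}$ with $f((s_i,s_j))=f((s_j,s_i))^{-1}$. A weighted Coxeter graph is a triple $\Gamma_f=(V,E,f)$ with $\Gamma=(V,E)$ a Coxeter graph and $f$ a legal weight function. The weight of a (directed) path is the product of the weights of the directed edges of which it consists; $\Gamma_f$ is balanced if the weight of every closed path equals $1$. Representation $\mathcal{R}_{\Gamma,f}$: the generator $s_i$ is sent to the $N\times N$ complex matrix $\omega_i$ that differs from the identity matrix only in its $i$-th row; this row has $-1$ in position $(i,i)$, has $f((s_i,s_j))\cdot 2\cos(\pi/m_{ij})$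 in position $(i,j)$ when $s_i$ and $s_j$ are joined by an edge (with $2\cos(\pi/\infty)=2$), and $0$ in position $(i,j)$ when $i\neq j$ and $s_i,s_j$ are not joined. The assignment $s_i\mapsto\omega_i$ extends to a group homomorphism $\mathcal{R}_{\Gamma,f}:W\to GL_N(\mathbb{C})$. Faithful means that this homomorphism is injective. *)

theory Defs
  imports
    Complex_Main
    "HOL-Library.Extended_Nat"
    "HOL-Library.FuncSet"
    "HOL-Algebra.Generated_Groups"
    "Jordan_Normal_Form.Matrix"
    "Graph_Theory.Pair_Digraph"
begin

section \<open>Groups given by generators and relations\<close>

text \<open>A word over an alphabet \<open>S\<close> is a list of signed letters: \<open>(x, True)\<close> stands for \<open>x\<close>
  and \<open>(x, False)\<close> for the formal inverse of \<open>x\<close>.\<close>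

type_synonym 'a word = "('a \<times> bool) list"

definition words :: "'a set \<Rightarrow> 'a word set" where
  "words S = lists (S \<times> UNIV)"

fun word_val :: "('a, 'b) monoid_scheme \<Rightarrow> 'a word \<Rightarrow> 'a" where
  "word_val G [] = \<one>\<^bsub>G\<^esub>"
| "word_val G ((x, b) # w) = (if b then x else inv\<^bsub>G\<^esub> x) \<otimes>\<^bsub>G\<^esub> word_val G w"

text \<open>Equality of words in the quotient of the free group on \<open>S\<close> by the normal closure of the
  relators \<open>R\<close>: the least congruence under which \<open>x x\<^sup>-\<^sup>1\<close>, \<open>x\<^sup>-\<^sup>1 x\<close> and all relators are trivial.\<close>

inductive pres_eq :: "'a set \<Rightarrow> 'a word set \<Rightarrow> 'a word \<Rightarrow> 'a word \<Rightarrow> bool"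
  for S :: "'a set" and R :: "'a word set" where
  pres_refl: "pres_eq S R w w"
| pres_sym: "pres_eq S R v w \<Longrightarrow> pres_eq S R w v"
| pres_trans: "pres_eq S R u v \<Longrightarrow> pres_eq S R v w \<Longrightarrow> pres_eq S R u w"
| pres_cancel: "x \<in> S \<Longrightarrow> pres_eq S R (u @ [(x, b), (x, \<not> b)] @ v) (u @ v)"
| pres_rel: "r \<in> R \<Longrightarrow> pres_eq S R (u @ r @ v) (u @ v)"

text \<open>The canonical map from the free group on \<open>S\<close> to \<open>G\<close> is onto and its kernel is the normal
  closure of the relators \<open>R\<close>.\<close>

definition presented_by :: "('a, 'b) monoid_scheme \<Rightarrow> 'a set \<Rightarrow> 'a word set \<Rightarrow> bool" where
  "presented_by G S R \<longleftrightarrow>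
     group G \<and> S \<subseteq> carrier G \<and> R \<subseteq> words S \<and> generate G S = carrier G \<and>
     (\<forall>w \<in> words S. word_val G w = \<one>\<^bsub>G\<^esub> \<longleftrightarrow> pres_eq S R w [])"

section \<open>Coxeter systems and weighted Coxeter graphs\<close>

text \<open>Only the values \<open>m s t\<close> for distinct \<open>s, t \<in> S\<close> matter; the relators \<open>s\<^sup>2\<close> are listed
  separately.\<close>

definition coxeter_relators :: "'a set \<Rightarrow> ('a \<Rightarrow> 'a \<Rightarrow> enat) \<Rightarrow> 'a word set" where
  "coxeter_relators S m =
     {[(s, True), (s, True)] | s. s \<in> S} \<union>
     {concat (replicate k [(s, True), (t, True)]) | s t k.
        s \<in> S \<and> t \<in> S \<and> s \<noteq> t \<and> m s t = enat k}"

definition coxeter_system ::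
  "('a, 'b) monoid_scheme \<Rightarrow> 'a set \<Rightarrow> ('a \<Rightarrow> 'a \<Rightarrow> enat) \<Rightarrow> bool" where
  "coxeter_system W S m \<longleftrightarrow>
     finite S \<and>
     (\<forall>s\<in>S. \<forall>t\<in>S. s \<noteq> t \<longrightarrow> m s t = m t s \<and> 2 \<le> m s t) \<and>
     presented_by W S (coxeter_relators S m)"

definition coxeter_edges :: "'a set \<Rightarrow> ('a \<Rightarrow> 'a \<Rightarrow> enat) \<Rightarrow> 'a set set" where
  "coxeter_edges S m = {{s, t} | s t. s \<in> S \<and> t \<in> S \<and> s \<noteq> t \<and> 3 \<le> m s t}"

text \<open>The symmetric digraph of the Coxeter graph: every edge is replaced by the two directed
  edges on its end points.\<close>

definition coxeter_digraph :: "'a set \<Rightarrow> ('a \<Rightarrow> 'a \<Rightarrow> enat) \<Rightarrow> 'a pair_pre_digraph" where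
  "coxeter_digraph S m = \<lparr> pverts = S, parcs = {(s, t). {s, t} \<in> coxeter_edges S m} \<rparr>"

definition legal_weight :: "'a pair_pre_digraph \<Rightarrow> ('a \<times> 'a \<Rightarrow> complex) \<Rightarrow> bool" where
  "legal_weight G f \<longleftrightarrow>
     (\<forall>(s, t) \<in> parcs G. f (s, t) \<noteq> 0 \<and> f (s, t) = inverse (f (t, s)))"

definition path_weight :: "('a \<times> 'a \<Rightarrow> complex) \<Rightarrow> ('a \<times> 'a) awalk \<Rightarrow> complex" where
  "path_weight f p = prod_list (map f p)"

text \<open>Closed paths may repeat vertices and edges.\<close>

definition balanced :: "'a pair_pre_digraph \<Rightarrow> ('a \<times> 'a \<Rightarrow> complex) \<Rightarrow> bool" where
  "balanced G f \<longleftrightarrow>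
     (\<forall>u p. pre_digraph.awalk (with_proj G) u p u \<longrightarrow> path_weight f p = 1)"

section \<open>The representation attached to a weighted Coxeter graph\<close>

definition GL :: "nat \<Rightarrow> complex mat monoid" where
  "GL N = units_of (ring_mat TYPE(complex) N ())"

definition two_cos :: "enat \<Rightarrow> real" where
  "two_cos k = (case k of enat n \<Rightarrow> 2 * cos (pi / real n) | \<infinity> \<Rightarrow> 2)"

text \<open>The generators are enumerated as \<open>s 0, \<dots>, s (N - 1)\<close>, so that rows and columns are
  numbered from \<open>0\<close>.\<close>

definition coxeter_omega ::
  "'a set \<Rightarrow> ('a \<Rightarrow> 'a \<Rightarrow> enat) \<Rightarrow> ('a \<times> 'a \<Rightarrow> complex) \<Rightarrow> nat \<Rightarrow> (nat \<Rightarrow> 'a) \<Rightarrow> nat \<Rightarrow> complex mat" where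
  "coxeter_omega S m f N s i = mat N N (\<lambda>(k, j).
     if k \<noteq> i then (if k = j then 1 else 0)
     else if j = i then - 1
     else if {s i, s j} \<in> coxeter_edges S m
       then f (s i, s j) * complex_of_real (two_cos (m (s i) (s j)))
     else 0)"

definition coxeter_rep ::
  "('a, 'b) monoid_scheme \<Rightarrow> 'a set \<Rightarrow> ('a \<Rightarrow> 'a \<Rightarrow> enat) \<Rightarrow> ('a \<times> 'a \<Rightarrow> complex) \<Rightarrow>
     nat \<Rightarrow> (nat \<Rightarrow> 'a) \<Rightarrow> 'a \<Rightarrow> complex mat" where
  "coxeter_rep W S m f N s =
     (THE \<rho>. \<rho> \<in> hom W (GL N) \<and> \<rho> \<in> extensional (carrier W) \<and>
        (\<forall>i<N. \<rho> (s i) = coxeter_omega S m f N s i))"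

end

theory Submission
  imports Defs "HOL-Algebra.Bij"
begin

text \<open>
  On a balanced graph the product of the weights along a path depends only on its end points, so
  \<open>f (a, b) = g a / g b\<close> for a potential \<open>g\<close>, and conjugation by the diagonal matrix of \<open>g\<close> turns
  the weighted representation into Tits' geometric representation. The latter is faithful because
  \<open>l (x s) \<ge> l x\<close> forces \<open>x\<close> to send the simple root of \<open>s\<close> to a nonnegative combination of simple
  roots: write \<open>x = v u\<close> with \<open>u\<close> in the dihedral subgroup of \<open>s\<close> and of a right descent \<open>t\<close> of
  \<open>x\<close>, lengths adding up with \<open>v\<close> as short as possible; induction applies to \<open>v\<close>, and \<open>u\<close> is treated
  by an explicit computation in rank two. Hence a nontrivial \<open>x\<close>, which has a right descent \<open>s\<close>,
  makes the simple root of \<open>s\<close> negative and cannot act trivially.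
\<close>

section \<open>The universal property of a presentation\<close>

lemma (in group) word_val_closed [simp, intro]:
  "fst ` set w \<subseteq> carrier G \<Longrightarrow> word_val G w \<in> carrier G"
  by (induction w) auto

lemma (in group) word_val_append:
  "fst ` set u \<subseteq> carrier G \<Longrightarrow> fst ` set v \<subseteq> carrier G \<Longrightarrow>
    word_val G (u @ v) = word_val G u \<otimes> word_val G v"
  by (induction u) (auto simp: m_assoc)

lemma (in group) pres_eq_imp_word_val_eq:
  assumes h: "\<And>x. h x \<in> carrier G"
    and R: "\<And>r. r \<in> R \<Longrightarrow> word_val G (map (apfst h) r) = \<one>"
    and "pres_eq S R u v"
  shows "word_val G (map (apfst h) u) = word_val G (map (apfst h) v)"
proof -
  define ev where "ev w = word_val G (map (apfst h) w)" for w
  have ev_closed [simp]: "ev w \<in> carrier G" for w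
    unfolding ev_def by (rule word_val_closed) (use h in auto)
  have ev_append: "ev (u @ v) = ev u \<otimes> ev v" for u v
    unfolding ev_def map_append by (rule word_val_append) (use h in auto)
  from assms(3) have "ev u = ev v"
  proof induction
    case (pres_cancel x u b v)
    have "ev [(x, b), (x, \<not> b)] = \<one>"
      using h by (simp add: ev_def)
    then show ?case by (simp only: ev_append) simp
  next
    case (pres_rel r u v)
    then have "ev r = \<one>" using R by (simp add: ev_def)
    then show ?case by (simp only: ev_append) simp
  qed auto
  then show ?thesis by (simp add: ev_def)
qed

lemma (in group) generate_word:
  assumes "S \<subseteq> carrier G" "x \<in> generate G S"
  shows "\<exists>w \<in> words S. word_val G w = x"
  using assms(2)
proof induction
  case one
  show ?case by (rule bexI[of _ "[]"]) (auto simp: words_def)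
next
  case (incl x)
  with assms(1) show ?case by (intro bexI[of _ "[(x, True)]"]) (auto simp: words_def)
next
  case (inv x)
  with assms(1) show ?case by (intro bexI[of _ "[(x, False)]"]) (auto simp: words_def)
next
  case (eng x y)
  then obtain u v where *: "u \<in> words S" "v \<in> words S" "word_val G u = x" "word_val G v = y"
    by auto
  then have "fst ` set u \<subseteq> carrier G" "fst ` set v \<subseteq> carrier G"
    using assms(1) by (auto simp: words_def in_lists_conv_set)
  with * show ?case
    by (intro bexI[of _ "u @ v"]) (auto simp: word_val_append words_def)
qed

text \<open>Von Dyck's theorem: words are evaluated in \<open>H\<close> through \<open>h\<close>. A
  word trivial in \<open>G\<close> is congruent to the empty word, hence evaluates to one in
  \<open>H\<close>, so the value depends only on the element of \<open>G\<close>.\<close>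

theorem presented_by_hom_exists:
  assumes pres: "presented_by G S R" and H: "group H"
    and hS: "\<And>x. x \<in> S \<Longrightarrow> h x \<in> carrier H"
    and rel: "\<And>r. r \<in> R \<Longrightarrow> word_val H (map (apfst h) r) = \<one>\<^bsub>H\<^esub>"
  shows "\<exists>\<rho> \<in> hom G H. \<forall>x\<in>S. \<rho> x = h x"
proof -
  interpret G: group G using pres by (simp add: presented_by_def)
  interpret H: group H by (rule H)
  have SG: "S \<subseteq> carrier G" and RS: "R \<subseteq> words S" and gen: "generate G S = carrier G"
    and ker: "\<And>w. w \<in> words S \<Longrightarrow> word_val G w = \<one>\<^bsub>G\<^esub> \<Longrightarrow> pres_eq S R w []"
    using pres by (auto simp: presented_by_def)
  \<comment> \<open>The congruence relates words with letters outside \<open>S\<close> as well, so \<open>h\<close> is made total.\<close>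
  define h' where "h' x = (if x \<in> S then h x else \<one>\<^bsub>H\<^esub>)" for x
  have h'c: "h' x \<in> carrier H" for x using hS by (simp add: h'_def)
  have h'_words: "map (apfst h') w = map (apfst h) w" if "w \<in> words S" for w
    using that by (auto simp: words_def in_lists_conv_set h'_def)
  define ev where "ev w = word_val H (map (apfst h') w)" for w
  have ev_closed: "ev w \<in> carrier H" for w
    unfolding ev_def by (rule H.word_val_closed) (use h'c in auto)
  have ev_append: "ev (u @ v) = ev u \<otimes>\<^bsub>H\<^esub> ev v" for u v
    unfolding ev_def map_append by (rule H.word_val_append) (use h'c in auto)
  have ev_one: "ev w = \<one>\<^bsub>H\<^esub>" if "w \<in> words S" "word_val G w = \<one>\<^bsub>G\<^esub>" for w
  proof -
    have "word_val H (map (apfst h') w) = word_val H (map (apfst h') [])"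
      by (rule H.pres_eq_imp_word_val_eq[OF h'c _ ker[OF that]])
        (use rel RS h'_words in \<open>metis subsetD\<close>)
    then show ?thesis by (simp add: ev_def)
  qed
  have wv_append: "word_val G (u @ v) = word_val G u \<otimes>\<^bsub>G\<^esub> word_val G v"
    if "u \<in> words S" "v \<in> words S" for u v
    using that SG by (intro G.word_val_append) (auto simp: words_def in_lists_conv_set)
  have wv_closed: "word_val G u \<in> carrier G" if "u \<in> words S" for u
    using that SG by (intro G.word_val_closed) (auto simp: words_def in_lists_conv_set)
  have words_app: "u @ v \<in> words S" if "u \<in> words S" "v \<in> words S" for u v
    using that by (auto simp: words_def)
  have ex: "\<exists>w. w \<in> words S \<and> word_val G w = x" if "x \<in> carrier G" for x
    using G.generate_word[OF SG] that gen by auto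
  have ev_cong: "ev u = ev v"
    if uv: "u \<in> words S" "v \<in> words S" "word_val G u = word_val G v" for u v
  proof -
    \<comment> \<open>Appending a common word \<open>z\<close> for the inverse reduces equality of
      values to the case of words that are trivial in \<open>G\<close>.\<close>
    obtain z where z: "z \<in> words S" "word_val G z = inv\<^bsub>G\<^esub> word_val G u"
      using ex wv_closed[OF uv(1)] by blast
    have "ev (u @ z) = \<one>\<^bsub>H\<^esub>" "ev (v @ z) = \<one>\<^bsub>H\<^esub>"
      by (rule ev_one, use uv z wv_closed[OF uv(1)] wv_closed[OF uv(2)] in
        \<open>auto simp: wv_append intro: words_app\<close>)+
    then show ?thesis
      by (metis ev_append ev_closed H.right_cancel)
  qed
  define w where "w x = (SOME w. w \<in> words S \<and> word_val G w = x)" for x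
  have w: "w x \<in> words S" "word_val G (w x) = x" if "x \<in> carrier G" for x
    using someI_ex[OF ex[OF that]] by (auto simp: w_def)
  have "(\<lambda>x. ev (w x)) \<in> hom G H"
  proof (rule homI)
    fix x y assume xy: "x \<in> carrier G" "y \<in> carrier G"
    have "ev (w (x \<otimes>\<^bsub>G\<^esub> y)) = ev (w x @ w y)"
      using w xy by (intro ev_cong words_app) (auto simp: wv_append)
    then show "ev (w (x \<otimes>\<^bsub>G\<^esub> y)) = ev (w x) \<otimes>\<^bsub>H\<^esub> ev (w y)"
      by (simp add: ev_append)
  qed (rule ev_closed)
  moreover have "ev (w x) = h x" if "x \<in> S" for x
  proof -
    have "ev (w x) = ev [(x, True)]"
      using that SG w by (intro ev_cong) (auto simp: words_def)
    then show ?thesis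
      using that hS by (simp add: ev_def h'_def)
  qed
  ultimately show ?thesis by (intro bexI[of _ "\<lambda>x. ev (w x)"] ballI)
qed

text \<open>Supplies the uniqueness that lets the definite description in \<open>coxeter_rep\<close>
  denote.\<close>

lemma hom_eq_on_generate:
  assumes "group G" "group H" "\<phi> \<in> hom G H" "\<psi> \<in> hom G H" "S \<subseteq> carrier G"
    and "\<And>x. x \<in> S \<Longrightarrow> \<phi> x = \<psi> x" and "x \<in> generate G S"
  shows "\<phi> x = \<psi> x"
proof -
  interpret G: group G by fact
  interpret \<phi>: group_hom G H \<phi> using assms by (simp add: group_hom_def group_hom_axioms_def)
  interpret \<psi>: group_hom G H \<psi> using assms by (simp add: group_hom_def group_hom_axioms_def)
  from assms(7) show ?thesis
  proof induction
    case (eng x y)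
    then show ?case using G.generate_in_carrier[OF assms(5)] by simp
  qed (use assms(5,6) in \<open>auto simp: subset_iff\<close>)
qed

section \<open>Word length\<close>

text \<open>No inverse letters occur because the generators in question are involutions. Letters are
  appended on the right, so that case analysis exposes the last letter. \<open>T\<close> is a
  parameter because lengths in a dihedral subgroup are played off against lengths over all of
  \<open>S\<close>.\<close>

inductive prod_of_length :: "('a, 'b) monoid_scheme \<Rightarrow> 'a set \<Rightarrow> nat \<Rightarrow> 'a \<Rightarrow> bool"
  for G T where
  prod_of_length_0: "prod_of_length G T 0 \<one>\<^bsub>G\<^esub>"
| prod_of_length_Suc:
    "prod_of_length G T n x \<Longrightarrow> t \<in> T \<Longrightarrow> prod_of_length G T (Suc n) (x \<otimes>\<^bsub>G\<^esub> t)"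

definition word_len :: "('a, 'b) monoid_scheme \<Rightarrow> 'a set \<Rightarrow> 'a \<Rightarrow> nat" where
  "word_len G T x = (LEAST n. prod_of_length G T n x)"

lemma prod_of_length_word_len:
  "prod_of_length G T n x \<Longrightarrow> prod_of_length G T (word_len G T x) x"
  unfolding word_len_def by (rule LeastI)

lemma word_len_le: "prod_of_length G T n x \<Longrightarrow> word_len G T x \<le> n"
  unfolding word_len_def by (rule Least_le)

lemma prod_of_length_mono:
  "prod_of_length G T n x \<Longrightarrow> T \<subseteq> T' \<Longrightarrow> prod_of_length G T' n x"
  by (induction rule: prod_of_length.induct) (auto intro: prod_of_length.intros)

context group
begin

lemma prod_of_length_closed: "prod_of_length G T n x \<Longrightarrow> T \<subseteq> carrier G \<Longrightarrow> x \<in> carrier G"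
  by (induction rule: prod_of_length.induct) auto

lemma prod_of_length_1: "t \<in> T \<Longrightarrow> T \<subseteq> carrier G \<Longrightarrow> prod_of_length G T 1 t"
  using prod_of_length_Suc[OF prod_of_length_0, of t T G] by auto

lemma prod_of_length_mult:
  assumes "prod_of_length G T k y" "prod_of_length G T n x" "T \<subseteq> carrier G"
  shows "prod_of_length G T (n + k) (x \<otimes> y)"
  using assms(1)
proof induction
  case prod_of_length_0
  then show ?case using assms prod_of_length_closed by simp
next
  case (prod_of_length_Suc k y t)
  have "x \<otimes> (y \<otimes> t) = (x \<otimes> y) \<otimes> t"
    using assms prod_of_length_Suc prod_of_length_closed by (metis m_assoc subsetD)
  then show ?case
    using prod_of_length.prod_of_length_Suc[OF prod_of_length_Suc.IH prod_of_length_Suc.hyps(2)]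
    by simp
qed

lemma prod_of_length_generate:
  assumes T: "T \<subseteq> carrier G" and inv: "\<And>t. t \<in> T \<Longrightarrow> t \<otimes> t = \<one>" and "x \<in> generate G T"
  shows "\<exists>n. prod_of_length G T n x"
  using assms(3)
proof induction
  case one
  show ?case using prod_of_length_0 by metis
next
  case (incl t)
  then show ?case using prod_of_length_1 T by metis
next
  case (inv t)
  then have "inv t = t" using T assms(2) by (meson inv_equality subsetD)
  then show ?case using prod_of_length_1 T inv by metis
next
  case (eng x y)
  then show ?case using prod_of_length_mult T by metis
qed

end

section \<open>Coefficients in rank two\<close>

text \<open>\<open>chebyshev (2 * cos \<theta>) k\<close> is \<open>U\<^sub>k\<^sub>-\<^sub>1 (cos \<theta>)\<close>, the Chebyshev polynomial of the second kind.\<close>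

fun chebyshev :: "real \<Rightarrow> nat \<Rightarrow> real" where
  "chebyshev c 0 = 0"
| "chebyshev c (Suc 0) = 1"
| "chebyshev c (Suc (Suc k)) = c * chebyshev c (Suc k) - chebyshev c k"

text \<open>The recursion matches sin((k+2)\<theta>) + sin(k\<theta>) = 2 cos \<theta>
  sin((k+1)\<theta>). With the factor \<open>sin \<theta>\<close> kept on the left there is no
  division.\<close>

lemma chebyshev_sin: "sin \<theta> * chebyshev (2 * cos \<theta>) k = sin (real k * \<theta>)"
proof (induction k rule: induct_nat_012)
  case (ge2 k)
  have eq: "real (Suc (Suc k)) * \<theta> = real (Suc k) * \<theta> + \<theta>" "real k * \<theta> = real (Suc k) * \<theta> - \<theta>"
    by (simp_all add: algebra_simps)
  have "sin \<theta> * chebyshev (2 * cos \<theta>) (Suc (Suc k)) =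
      2 * cos \<theta> * sin (real (Suc k) * \<theta>) - sin (real k * \<theta>)"
    using ge2 by (simp add: algebra_simps)
  also have "\<dots> = sin (real (Suc (Suc k)) * \<theta>)"
    unfolding eq sin_add sin_diff by (simp add: algebra_simps)
  finally show ?case .
qed auto

lemma chebyshev_two: "chebyshev 2 k = real k"
  by (induction k rule: induct_nat_012) auto

text \<open>For \<open>M = enat n\<close> the angle \<open>real k * (pi / real n)\<close> lies
  between 0 and \<open>pi\<close>, where the sine is nonnegative; for infinite order the value is
  \<open>k\<close> itself.\<close>

lemma chebyshev_two_cos_nonneg:
  assumes "enat k \<le> M" "2 \<le> M"
  shows "0 \<le> chebyshev (two_cos M) k"
proof (cases M)
  case (enat n)
  with assms have n: "2 \<le> n" "k \<le> n" by (auto simp: numeral_eq_enat)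
  define \<theta> where "\<theta> = pi / real n"
  have "0 < \<theta>" "\<theta> < pi" using n pi_gt_zero by (auto simp: \<theta>_def field_simps)
  then have "0 < sin \<theta>" by (rule sin_gt_zero)
  moreover have "0 \<le> sin (real k * \<theta>)"
    using n by (intro sin_ge_zero) (auto simp: \<theta>_def field_simps)
  ultimately show ?thesis
    unfolding chebyshev_sin[symmetric] using enat
    by (simp add: two_cos_def \<theta>_def zero_le_mult_iff)
next
  case infinity
  then show ?thesis by (simp add: two_cos_def chebyshev_two)
qed

section \<open>Positivity of roots\<close>

text \<open>The last letter is \<open>t\<close>.\<close>

fun alternating :: "('a, 'b) monoid_scheme \<Rightarrow> 'a \<Rightarrow> 'a \<Rightarrow> nat \<Rightarrow> 'a" where
  "alternating G s t 0 = \<one>\<^bsub>G\<^esub>"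
| "alternating G s t (Suc k) = alternating G t s k \<otimes>\<^bsub>G\<^esub> t"

context group
begin

lemma alternating_closed [simp]:
  "s \<in> carrier G \<Longrightarrow> t \<in> carrier G \<Longrightarrow> alternating G s t k \<in> carrier G"
  by (induction k arbitrary: s t) auto

lemma prod_of_length_alternating: "prod_of_length G {s, t} k (alternating G s t k)"
proof (induction k arbitrary: s t)
  case (Suc k)
  from Suc[of t s] show ?case
    by (auto intro: prod_of_length_Suc simp: insert_commute)
qed (auto intro: prod_of_length_0)

lemma involution_inv: "x \<in> carrier G \<Longrightarrow> x \<otimes> x = \<one> \<Longrightarrow> inv x = x"
  by (rule inv_equality)

text \<open>Inverting an alternating word of involutions reverses it, so the left side is the
  alternating word of length \<open>2 * k\<close> that starts with \<open>s\<close> and ends with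
  \<open>t\<close>.\<close>

lemma alternating_quotient:
  assumes st: "s \<in> carrier G" "t \<in> carrier G" and inv: "s \<otimes> s = \<one>" "t \<otimes> t = \<one>"
  shows "inv (alternating G t s k) \<otimes> alternating G s t k = (s \<otimes> t) [^] k"
  using assms
proof (induction k arbitrary: s t)
  case (Suc k)
  \<comment> \<open>The outer letters are peeled off, which leaves the quotient of length
    \<open>k\<close> with \<open>s\<close> and \<open>t\<close> exchanged.\<close>
  have "inv (alternating G t s (Suc k)) \<otimes> alternating G s t (Suc k)
      = s \<otimes> (inv (alternating G s t k) \<otimes> alternating G t s k) \<otimes> t"
    using Suc.prems by (simp add: inv_mult_group involution_inv m_assoc)
  also have "\<dots> = s \<otimes> (t \<otimes> s) [^] k \<otimes> t"
    using Suc by simp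
  also have "\<dots> = (s \<otimes> t) [^] Suc k"
  proof (induction k)
    case (Suc k)
    have "s \<otimes> (t \<otimes> s) [^] Suc k \<otimes> t = (s \<otimes> (t \<otimes> s) [^] k \<otimes> t) \<otimes> (s \<otimes> t)"
      using \<open>s \<in> carrier G\<close> \<open>t \<in> carrier G\<close> by (simp add: m_assoc)
    then show ?case using Suc by simp
  qed (use \<open>s \<in> carrier G\<close> \<open>t \<in> carrier G\<close> in simp)
  finally show ?case .
qed auto

text \<open>The quotient of the two words is a power of \<open>s \<otimes> t\<close>, so the order
  relation turns into the braid relation.\<close>

lemma alternating_braid:
  assumes "s \<in> carrier G" "t \<in> carrier G" "s \<otimes> s = \<one>" "t \<otimes> t = \<one>"
    and "(s \<otimes> t) [^] k = \<one>"
  shows "alternating G s t k = alternating G t s k"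
proof -
  have "inv (alternating G s t k) = inv (alternating G t s k)"
    using alternating_quotient[OF assms(1-4), of k] assms by (intro inv_equality) auto
  then have "inv (inv (alternating G s t k)) = inv (inv (alternating G t s k))"
    by simp
  then show ?thesis using assms by simp
qed

end

definition simple_root :: "'a \<Rightarrow> 'a \<Rightarrow> real" where
  "simple_root s = (\<lambda>t. of_bool (t = s))"

text \<open>Isolates what the positivity argument uses: the Coxeter relations and a linear action
  given by reflections on simple roots. Linearity is stated for two-term combinations, as rank two
  computations require.\<close>

locale coxeter_action = group W for W (structure) +
  fixes S :: "'a set" and m :: "'a \<Rightarrow> 'a \<Rightarrow> enat" and act :: "'a \<Rightarrow> ('a \<Rightarrow> real) \<Rightarrow> 'a \<Rightarrow> real"
  assumes S_closed: "S \<subseteq> carrier W"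
    and generates: "generate W S = carrier W"
    and involution: "s \<in> S \<Longrightarrow> s \<otimes> s = \<one>"
    and braid: "s \<in> S \<Longrightarrow> t \<in> S \<Longrightarrow> s \<noteq> t \<Longrightarrow> m s t = enat k \<Longrightarrow> (s \<otimes> t) [^] k = \<one>"
    and m_sym: "s \<in> S \<Longrightarrow> t \<in> S \<Longrightarrow> s \<noteq> t \<Longrightarrow> m s t = m t s"
    and m_ge_2: "s \<in> S \<Longrightarrow> t \<in> S \<Longrightarrow> s \<noteq> t \<Longrightarrow> 2 \<le> m s t"
    and act_one: "act \<one> v = v"
    and act_mult: "x \<in> carrier W \<Longrightarrow> y \<in> carrier W \<Longrightarrow> act (x \<otimes> y) v = act x (act y v)"
    and act_linear: "x \<in> carrier W \<Longrightarrow>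
      act x (\<lambda>r. a * u r + b * v r) = (\<lambda>r. a * act x u r + b * act x v r)"
    and act_self: "s \<in> S \<Longrightarrow> act s (simple_root s) = (\<lambda>r. - simple_root s r)"
    and act_other: "s \<in> S \<Longrightarrow> t \<in> S \<Longrightarrow> s \<noteq> t \<Longrightarrow>
      act s (simple_root t) = (\<lambda>r. simple_root t r + two_cos (m s t) * simple_root s r)"
begin

lemma in_carrier [simp]: "s \<in> S \<Longrightarrow> s \<in> carrier W"
  using S_closed by auto

lemma mult_gen_gen [simp]: "x \<in> carrier W \<Longrightarrow> s \<in> S \<Longrightarrow> x \<otimes> s \<otimes> s = x"
  by (simp add: m_assoc involution)

lemma gen_mult_gen [simp]: "x \<in> carrier W \<Longrightarrow> s \<in> S \<Longrightarrow> s \<otimes> (s \<otimes> x) = x"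
  by (simp add: m_assoc[symmetric] involution)

lemma prod_of_length_exists: "x \<in> carrier W \<Longrightarrow> \<exists>n. prod_of_length W S n x"
  using prod_of_length_generate[OF S_closed] involution generates by auto

lemma prod_of_length_word_len_S: "x \<in> carrier W \<Longrightarrow> prod_of_length W S (word_len W S x) x"
  using prod_of_length_exists prod_of_length_word_len by metis

text \<open>Each reflection keeps one coefficient and replaces the other by the next Chebyshev
  value. The offset \<open>j\<close> makes the induction go through, as the letter acting first
  shifts it by one; \<open>p\<close> and \<open>q\<close> only record which root carries which
  coefficient.\<close>

lemma act_alternating:
  assumes "s \<in> S" "t \<in> S" "s \<noteq> t"
  defines "c \<equiv> two_cos (m s t)"
  shows "\<exists>p\<in>{s, t}. \<exists>q\<in>{s, t}. act (alternating W s t k)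
      (\<lambda>r. chebyshev c (Suc j) * simple_root s r + chebyshev c j * simple_root t r) =
      (\<lambda>r. chebyshev c (Suc (j + k)) * simple_root p r + chebyshev c (j + k) * simple_root q r)"
  using assms(1-3) unfolding c_def
proof (induction k arbitrary: s t j)
  case 0
  then show ?case by (auto simp: act_one)
next
  case (Suc k)
  define c where "c = two_cos (m s t)"
  have c': "two_cos (m t s) = c" using Suc.prems m_sym by (simp add: c_def)
  have "act t (\<lambda>r. chebyshev c (Suc j) * simple_root s r + chebyshev c j * simple_root t r)
     = (\<lambda>r. chebyshev c (Suc (Suc j)) * simple_root t r + chebyshev c (Suc j) * simple_root s r)"
    using Suc.prems by (simp add: act_linear act_self act_other c' fun_eq_iff) (simp add: algebra_simps)
  then have "act (alternating W s t (Suc k))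
      (\<lambda>r. chebyshev c (Suc j) * simple_root s r + chebyshev c j * simple_root t r) =
    act (alternating W t s k)
      (\<lambda>r. chebyshev c (Suc (Suc j)) * simple_root t r + chebyshev c (Suc j) * simple_root s r)"
    using Suc.prems by (simp add: act_mult del: chebyshev.simps)
  then show ?case
    using Suc.IH[of t s "Suc j"] Suc.prems by (auto simp: c' simp flip: c_def simp del: chebyshev.simps)
qed

text \<open>A reduced word in two involutions alternates, and it cannot end in \<open>s\<close>
  because \<open>s\<close> does not shorten it.\<close>

lemma dihedral_normal_form:
  assumes st: "s \<in> S" "t \<in> S" "s \<noteq> t"
    and u: "prod_of_length W {s, t} n u" "word_len W {s, t} u = n"
    and len: "n \<le> word_len W {s, t} (u \<otimes> s)"
  shows "u = alternating W s t n \<and> enat n < m s t"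
  using assms
proof (induction n arbitrary: s t u)
  case 0
  have "prod_of_length W {s, t} 0 u"
    using 0 by simp
  then have "u = \<one>" by cases
  moreover have "0 < m s t" by (rule less_le_trans[OF _ m_ge_2[OF 0(1,2,3)]]) simp
  ultimately show ?case by (simp add: zero_enat_def)
next
  case (Suc k)
  let ?T = "{s, t}"
  have T: "?T \<subseteq> carrier W" using Suc.prems by simp
  obtain y r where y: "u = y \<otimes> r" "prod_of_length W ?T k y" "r \<in> ?T"
    using Suc.prems(4) by cases auto
  have yc: "y \<in> carrier W" using prod_of_length_closed[OF y(2) T] .
  have "r \<noteq> s"
  proof
    assume "r = s"
    then have "u \<otimes> s = y" using y yc Suc.prems by simp
    then show False using word_len_le[OF y(2)] Suc.prems(6) by simp
  qed
  then have r: "r = t" using y by simp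
  have ylen: "word_len W ?T y = k"
  proof -
    have "prod_of_length W ?T (Suc (word_len W ?T y)) u"
      unfolding y(1) by (intro prod_of_length_Suc prod_of_length_word_len[OF y(2)] y(3))
    from word_len_le[OF this] show ?thesis using word_len_le[OF y(2)] Suc.prems(5) by simp
  qed
  \<comment> \<open>The induction hypothesis is used with \<open>s\<close> and \<open>t\<close>
    exchanged: appending \<open>t\<close> to \<open>y\<close> gives \<open>u\<close>, of length
    \<open>Suc k\<close>, so \<open>t\<close> does not shorten \<open>y\<close>.\<close>
  have "y = alternating W t s k \<and> enat k < m t s"
  proof (rule Suc.IH)
    show "k \<le> word_len W {t, s} (y \<otimes> t)"
      using y(1) r Suc.prems(5) by (simp add: insert_commute)
  qed (use Suc.prems y ylen in \<open>auto simp: insert_commute\<close>)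
  then have y': "y = alternating W t s k" "enat k < m s t"
    using Suc.prems m_sym by auto
  then have u': "u = alternating W s t (Suc k)" using y r by simp
  \<comment> \<open>At length \<open>m s t\<close> the braid relation would rewrite \<open>u\<close>
    to end in \<open>s\<close>, and then \<open>s\<close> would shorten it.\<close>
  have "m s t \<noteq> enat (Suc k)"
  proof
    assume "m s t = enat (Suc k)"
    then have "u = alternating W t s (Suc k)"
      using u' alternating_braid[of s t "Suc k"] braid[of s t "Suc k"] involution Suc.prems by simp
    then have "u \<otimes> s = alternating W s t k" using Suc.prems by simp
    then have "word_len W ?T (u \<otimes> s) \<le> k"
      using word_len_le[OF prod_of_length_alternating] by metis
    then show False using Suc.prems(6) by simp
  qed
  moreover have "enat (Suc k) \<le> m s t"
    using y'(2) by (simp add: Suc_ile_eq)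
  ultimately show ?case using u' by simp
qed

text \<open>The weak inequality in the hypothesis spares a parity argument showing that the two
  lengths differ. Induction is over all \<open>s\<close> at once, since the hypothesis is applied to
  a shorter element and both generators of a dihedral subgroup.\<close>

theorem act_simple_root_nonneg:
  assumes "x \<in> carrier W" "s \<in> S" "word_len W S x \<le> word_len W S (x \<otimes> s)"
  shows "0 \<le> act x (simple_root s) r"
  using assms
proof (induction "word_len W S x" arbitrary: x s r rule: less_induct)
  case less
  define n where "n = word_len W S x"
  have nx: "prod_of_length W S n x"
    using prod_of_length_word_len_S less.prems by (simp add: n_def)
  show ?case
  proof (cases n)
    case 0
    with nx have "prod_of_length W S 0 x" by simp
    then have "x = \<one>" by cases
    then show ?thesis by (simp add: act_one simple_root_def)
  next
    case (Suc n')
    with nx have "prod_of_length W S (Suc n') x" by simp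
    then obtain y t where y: "x = y \<otimes> t" "prod_of_length W S n' y" "t \<in> S"
      by cases auto
    have yc: "y \<in> carrier W" using prod_of_length_closed[OF y(2) S_closed] .
    have "s \<noteq> t"
    proof
      assume "s = t"
      then have "x \<otimes> s = y" using y yc by simp
      then show False using word_len_le[OF y(2)] less.prems(3) Suc n_def by simp
    qed
    define T where "T = {s, t}"
    have TS: "T \<subseteq> S" and T: "T \<subseteq> carrier W" using y less.prems by (auto simp: T_def)
    \<comment> \<open>Lengths add up in \<open>x = v \<otimes> u\<close>, and \<open>v\<close> is as short as possible: a minimal coset representative.\<close>
    define split where "split k \<longleftrightarrow>
      (\<exists>v u j. x = v \<otimes> u \<and> prod_of_length W S k v \<and> prod_of_length W T j u \<and> k + j = n)" for k
    define k where "k = (LEAST k. split k)"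
    \<comment> \<open>The reduced expression \<open>x = y \<otimes> t\<close> is such a splitting
      with \<open>j = 1\<close>. It forces \<open>k < n\<close>, so the induction hypothesis reaches
      \<open>v\<close>.\<close>
    have "split n'"
      unfolding split_def using y Suc T prod_of_length_1[of t T] by (auto simp: T_def)
    then have "split k" "k \<le> n'" unfolding k_def by (auto intro: LeastI Least_le)
    then obtain v u j where vu: "x = v \<otimes> u" "prod_of_length W S k v" "prod_of_length W T j u" "k + j = n"
      by (auto simp: split_def)
    have vc: "v \<in> carrier W" and uc: "u \<in> carrier W"
      using prod_of_length_closed vu S_closed T by metis+
    \<comment> \<open>No factorization of \<open>x\<close> is shorter than \<open>n\<close> in
      total, so both factors of the chosen splitting have exact lengths \<open>k\<close> and
      \<open>j\<close>.\<close>
    have lower: "n \<le> a + b" if "x = v' \<otimes> u'" "prod_of_length W S a v'" "prod_of_length W T b u'" for v' u' a b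
      using word_len_le[OF prod_of_length_mult[OF prod_of_length_mono[OF that(3) TS] that(2) S_closed]]
      by (simp add: n_def that)
    have vlen: "word_len W S v = k"
      using lower[OF vu(1) prod_of_length_word_len[OF vu(2)] vu(3)] word_len_le[OF vu(2)] vu(4) by simp
    have ulen: "word_len W T u = j"
      using lower[OF vu(1,2) prod_of_length_word_len[OF vu(3)]] word_len_le[OF vu(3)] vu(4) by simp
    \<comment> \<open>If some \<open>p\<close> in \<open>T\<close> shortened \<open>v\<close>,
      moving \<open>p\<close> over to \<open>u\<close> would give a splitting with a shorter left
      factor, against the choice of \<open>k\<close>.\<close>
    have vpos: "0 \<le> act v (simple_root p) r" if p: "p \<in> T" for p r
    proof (rule less.hyps)
      show "word_len W S v < word_len W S x" using vlen \<open>k \<le> n'\<close> Suc n_def by simp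
      show "word_len W S v \<le> word_len W S (v \<otimes> p)"
      proof (rule ccontr)
        define k' where "k' = word_len W S (v \<otimes> p)"
        assume "\<not> ?thesis"
        then have "k' < k" using vlen k'_def by simp
        have pS: "p \<in> S" using p TS by auto
        have 1: "prod_of_length W S k' (v \<otimes> p)"
          using prod_of_length_word_len_S vc pS by (simp add: k'_def)
        have 2: "prod_of_length W T (1 + j) (p \<otimes> u)"
          using prod_of_length_mult[OF vu(3) prod_of_length_1[OF p T] T] .
        have 3: "x = (v \<otimes> p) \<otimes> (p \<otimes> u)"
          using vu(1) vc uc pS by (simp add: m_assoc)
        have "k' + (1 + j) = n" using lower[OF 3 1 2] \<open>k' < k\<close> vu(4) by simp
        then have "split k'" unfolding split_def using 1 2 3 by blast
        then have "k \<le> k'" unfolding k_def by (rule Least_le)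
        then show False using \<open>k' < k\<close> by simp
      qed
    qed (use vc p TS in auto)
    \<comment> \<open>Lengths add up in the splitting, so if \<open>s\<close> shortened
      \<open>u\<close> inside the dihedral subgroup it would shorten \<open>x\<close> as
      well.\<close>
    have "word_len W T u \<le> word_len W T (u \<otimes> s)"
    proof (rule ccontr)
      assume "\<not> ?thesis"
      moreover have "prod_of_length W T (Suc j) (u \<otimes> s)"
        using vu(3) by (auto intro: prod_of_length_Suc simp: T_def)
      then have "prod_of_length W S (word_len W T (u \<otimes> s)) (u \<otimes> s)"
        by (intro prod_of_length_mono[OF prod_of_length_word_len TS])
      then have "word_len W S (v \<otimes> (u \<otimes> s)) \<le> k + word_len W T (u \<otimes> s)"
        by (intro word_len_le prod_of_length_mult[OF _ vu(2) S_closed])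
      moreover have "v \<otimes> (u \<otimes> s) = x \<otimes> s"
        using vu(1) vc uc less.prems by (simp add: m_assoc)
      ultimately show False
        using less.prems(3) ulen vu(4) n_def by simp
    qed
    then have u: "u = alternating W s t j" "enat j < m s t"
      using dihedral_normal_form[of s t j u] vu(3) less.prems y(3) \<open>s \<noteq> t\<close> ulen
      by (auto simp: T_def)
    define c where "c = two_cos (m s t)"
    \<comment> \<open>The simple root of \<open>s\<close> is the combination with coefficients
      \<open>chebyshev c 1 = 1\<close> and \<open>chebyshev c 0 = 0\<close>, the case of offset
      0.\<close>
    obtain p q where pq: "p \<in> T" "q \<in> T" "act u (simple_root s) =
        (\<lambda>r. chebyshev c (Suc j) * simple_root p r + chebyshev c j * simple_root q r)"
    proof -
      have "act u (\<lambda>r. chebyshev c (Suc 0) * simple_root s r + chebyshev c 0 * simple_root t r) =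
          act u (simple_root s)"
        by simp
      then show thesis
        using act_alternating[of s t j 0] less.prems y(3) \<open>s \<noteq> t\<close> u(1) that
        by (auto simp: T_def simp flip: c_def simp del: chebyshev.simps)
    qed
    \<comment> \<open>The strict bound \<open>enat j < m s t\<close> is what admits the index
      \<open>Suc j\<close>.\<close>
    have "0 \<le> chebyshev c (Suc j)" "0 \<le> chebyshev c j"
      unfolding c_def using u(2) m_ge_2[of s t] less.prems y(3) \<open>s \<noteq> t\<close>
      by (auto intro!: chebyshev_two_cos_nonneg simp: Suc_ile_eq)
    moreover have "act x (simple_root s) r =
        chebyshev c (Suc j) * act v (simple_root p) r + chebyshev c j * act v (simple_root q) r"
      using vu(1) vc uc by (simp add: act_mult pq(3) act_linear)
    ultimately show ?thesis
      using vpos pq by simp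
  qed
qed

text \<open>The last letter \<open>s\<close> of a reduced word for \<open>x\<close> works:
  positivity applies to \<open>x \<otimes> s\<close>, and \<open>s\<close> negates its own simple
  root.\<close>

theorem exists_negative_root:
  assumes "x \<in> carrier W" "x \<noteq> \<one>"
  shows "\<exists>s\<in>S. \<forall>r. act x (simple_root s) r \<le> 0"
proof -
  have x: "prod_of_length W S (word_len W S x) x"
    using prod_of_length_word_len_S assms by simp
  then obtain n y s where y: "word_len W S x = Suc n" "x = y \<otimes> s" "prod_of_length W S n y" "s \<in> S"
    using assms(2) by cases auto
  have yc: "y \<in> carrier W" using prod_of_length_closed[OF y(3) S_closed] .
  have "word_len W S y \<le> word_len W S (y \<otimes> s)"
    using word_len_le[OF y(3)] y(1,2) by simp
  then have "0 \<le> act y (simple_root s) r" for r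
    using act_simple_root_nonneg yc y(4) by simp
  moreover have "act x (simple_root s) r = - act y (simple_root s) r" for r
    using act_linear[OF yc, of "-1" "simple_root s" 0 "simple_root s"] y yc
    by (simp add: act_mult act_self fun_eq_iff)
  ultimately show ?thesis using y(4) by (intro bexI[of _ s]) auto
qed

end

section \<open>The geometric representation\<close>

text \<open>Twice the pairing with the simple root of \<open>s\<close> in Tits' bilinear form. The
  diagonal term is separate because \<open>m s s\<close> is unconstrained.\<close>

definition coroot :: "'a set \<Rightarrow> ('a \<Rightarrow> 'a \<Rightarrow> enat) \<Rightarrow> 'a \<Rightarrow> ('a \<Rightarrow> real) \<Rightarrow> real" where
  "coroot S m s v = 2 * v s - (\<Sum>t\<in>S - {s}. two_cos (m s t) * v t)"

definition geom_refl ::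
  "'a set \<Rightarrow> ('a \<Rightarrow> 'a \<Rightarrow> enat) \<Rightarrow> 'a \<Rightarrow> ('a \<Rightarrow> real) \<Rightarrow> 'a \<Rightarrow> real" where
  "geom_refl S m s v = (\<lambda>r. v r - coroot S m s v * simple_root s r)"

lemma coroot_diff: "coroot S m s (\<lambda>r. u r - v r) = coroot S m s u - coroot S m s v"
  by (simp add: coroot_def sum_subtractf right_diff_distrib)

lemma coroot_scale: "coroot S m s (\<lambda>r. a * v r) = a * coroot S m s v"
  by (simp add: coroot_def sum_distrib_left algebra_simps)

lemma coroot_linear:
  "coroot S m s (\<lambda>r. a * u r + b * v r) = a * coroot S m s u + b * coroot S m s v"
  by (simp add: coroot_def sum.distrib sum_distrib_left algebra_simps)

lemma coroot_self: "coroot S m s (simple_root s) = 2"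
  by (simp add: coroot_def simple_root_def)

lemma coroot_other:
  assumes "finite S" "t \<in> S" "s \<noteq> t"
  shows "coroot S m s (simple_root t) = - two_cos (m s t)"
proof -
  have "(\<Sum>r\<in>S - {s}. two_cos (m s r) * of_bool (r = t)) = (\<Sum>r\<in>S - {s}. if r = t then two_cos (m s t) else 0)"
    by (rule sum.cong) auto
  then show ?thesis using assms by (simp add: coroot_def simple_root_def)
qed

lemma geom_refl_linear:
  "geom_refl S m s (\<lambda>r. a * u r + b * v r) = (\<lambda>r. a * geom_refl S m s u r + b * geom_refl S m s v r)"
  by (simp add: geom_refl_def coroot_linear algebra_simps)

lemma geom_refl_self: "geom_refl S m s (simple_root s) = (\<lambda>r. - simple_root s r)"
  by (simp add: geom_refl_def coroot_self)

lemma geom_refl_other: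
  assumes "finite S" "t \<in> S" "s \<noteq> t"
  shows "geom_refl S m s (simple_root t) = (\<lambda>r. simple_root t r + two_cos (m s t) * simple_root s r)"
  by (simp add: geom_refl_def coroot_other[OF assms])

lemma geom_refl_involution: "geom_refl S m s (geom_refl S m s v) = v"
  by (simp add: geom_refl_def coroot_diff coroot_scale coroot_self)

text \<open>Powers of the product are computed in closed form on an arbitrary vector, with no
  splitting into the plane of the two roots and a complement. The coefficients vanish at
  \<open>k\<close> because \<open>2 * real k * \<theta>\<close> is a full turn.\<close>

lemma geom_refl_braid:
  assumes S: "finite S" "s \<in> S" "t \<in> S" "s \<noteq> t" and m: "m s t = enat k" "m t s = enat k" and k: "2 \<le> k"
  shows "((geom_refl S m s \<circ> geom_refl S m t) ^^ k) v = v"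
proof -
  define \<theta> where "\<theta> = pi / real k"
  have "0 < \<theta>" "\<theta> < pi" using k pi_gt_zero by (auto simp: \<theta>_def field_simps)
  then have sin: "sin \<theta> \<noteq> 0" using sin_gt_zero by force
  define p where "p = coroot S m s v"
  define q where "q = coroot S m t v"
  \<comment> \<open>Common denominator of the closed forms below: telescoping the sums of sines
    contributes \<open>2 * sin \<theta>\<close>, and each summand is itself divided by
    \<open>sin \<theta>\<close>.\<close>
  define D where "D = 2 * (sin \<theta>)\<^sup>2"
  have D: "D \<noteq> 0" using sin by (simp add: D_def)
  \<comment> \<open>The \<open>j\<close>-th reflection, counted from \<open>0\<close>, subtracts
    \<open>(q * sin ((j + 1) * \<theta>) + p * sin (j * \<theta>)) / sin \<theta>\<close> times its root; \<open>A n\<close> and \<open>B n\<close> are the sums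
    of these over the first \<open>n\<close> even and odd \<open>j\<close>.\<close>
  define A where "A n = (q * (1 - cos (2 * real n * \<theta>)) + p * (cos \<theta> - cos (2 * real n * \<theta> - \<theta>))) / D" for n :: nat
  define B where "B n = (q * (cos \<theta> - cos (2 * real n * \<theta> + \<theta>)) + p * (1 - cos (2 * real n * \<theta>))) / D" for n :: nat
  have DA: "D * A n = q * (1 - cos (2 * real n * \<theta>)) + p * (cos \<theta> - cos (2 * real n * \<theta> - \<theta>))" for n
    using D by (simp add: A_def)
  have DB: "D * B n = q * (cos \<theta> - cos (2 * real n * \<theta> + \<theta>)) + p * (1 - cos (2 * real n * \<theta>))" for n
    using D by (simp add: B_def)
  have prod: "2 * cos \<theta> * cos x = cos (x + \<theta>) + cos (x - \<theta>)" for x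
    by (simp add: cos_add cos_diff)
  have DD: "D = 2 - 2 * cos \<theta> * cos \<theta>"
    by (simp add: D_def sin_squared_eq) (simp add: power2_eq_square)
  \<comment> \<open>The recursion imposed by the reflection: \<open>coroot S m t\<close> of the
    current vector is \<open>q - 2 * A n + 2 * cos \<theta> * B n\<close>, which is added to
    \<open>A n\<close>. The reflection in \<open>s\<close> comes second, hence
    \<open>A (Suc n)\<close> in the recursion for \<open>B\<close>.\<close>
  have A_Suc: "A (Suc n) = q - A n + 2 * cos \<theta> * B n" for n
  proof -
    define \<psi> where "\<psi> = 2 * real n * \<theta>"
    have \<psi>: "2 * real (Suc n) * \<theta> = \<psi> + \<theta> + \<theta>" by (simp add: \<psi>_def algebra_simps)
    have "D * (q - A n + 2 * cos \<theta> * B n) = q * D - D * A n + 2 * cos \<theta> * (D * B n)"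
      by (simp add: algebra_simps)
    also have "\<dots> = q * D - (q * (1 - cos \<psi>) + p * (cos \<theta> - cos (\<psi> - \<theta>)))
        + (q * (2 * cos \<theta> * cos \<theta> - 2 * cos \<theta> * cos (\<psi> + \<theta>)) + p * (2 * cos \<theta> - 2 * cos \<theta> * cos \<psi>))"
      unfolding DA DB \<psi>_def[symmetric] by (simp add: algebra_simps)
    also have "\<dots> = D * A (Suc n)"
      unfolding DA \<psi> prod[of \<psi>] prod[of "\<psi> + \<theta>"] unfolding DD by (simp add: algebra_simps)
    finally show ?thesis using D by simp
  qed
  have B_Suc: "B (Suc n) = p - B n + 2 * cos \<theta> * A (Suc n)" for n
  proof -
    define \<psi> where "\<psi> = 2 * real n * \<theta>"
    have \<psi>: "2 * real (Suc n) * \<theta> = \<psi> + \<theta> + \<theta>" by (simp add: \<psi>_def algebra_simps)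
    have "D * (p - B n + 2 * cos \<theta> * A (Suc n)) = p * D - D * B n + 2 * cos \<theta> * (D * A (Suc n))"
      by (simp add: algebra_simps)
    also have "\<dots> = p * D - (q * (cos \<theta> - cos (\<psi> + \<theta>)) + p * (1 - cos \<psi>))
        + (q * (2 * cos \<theta> - 2 * cos \<theta> * cos (\<psi> + \<theta> + \<theta>)) + p * (2 * cos \<theta> * cos \<theta> - 2 * cos \<theta> * cos (\<psi> + \<theta>)))"
      unfolding DA DB \<psi> \<psi>_def[symmetric] by (simp add: algebra_simps)
    also have "\<dots> = D * B (Suc n)"
      unfolding DB \<psi> prod[of "\<psi> + \<theta> + \<theta>"] prod[of "\<psi> + \<theta>"] unfolding DD by (simp add: algebra_simps)
    finally show ?thesis using D by simp
  qed
  have c: "two_cos (m s t) = 2 * cos \<theta>" "two_cos (m t s) = 2 * cos \<theta>"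
    using m by (simp_all add: two_cos_def \<theta>_def)
  have "((geom_refl S m s \<circ> geom_refl S m t) ^^ n) v =
      (\<lambda>r. v r - A n * simple_root t r - B n * simple_root s r)" for n
  proof (induction n)
    case 0
    then show ?case by (simp add: A_def B_def)
  next
    case (Suc n)
    let ?w = "\<lambda>r. v r - A n * simple_root t r - B n * simple_root s r"
    have t: "coroot S m t ?w = A (Suc n) - A n"
      using S by (simp add: coroot_diff coroot_scale coroot_self coroot_other c A_Suc q_def)
    have 1: "geom_refl S m t ?w = (\<lambda>r. v r - A (Suc n) * simple_root t r - B n * simple_root s r)"
      unfolding geom_refl_def t by (simp add: algebra_simps)
    have s: "coroot S m s (\<lambda>r. v r - A (Suc n) * simple_root t r - B n * simple_root s r) = B (Suc n) - B n"
      using S by (simp add: coroot_diff coroot_scale coroot_self coroot_other c B_Suc p_def)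
    have "geom_refl S m s (\<lambda>r. v r - A (Suc n) * simple_root t r - B n * simple_root s r) =
        (\<lambda>r. v r - A (Suc n) * simple_root t r - B (Suc n) * simple_root s r)"
      unfolding geom_refl_def s by (simp add: algebra_simps)
    then show ?case using Suc 1 by simp
  qed
  moreover have "A k = 0" "B k = 0"
  proof -
    have *: "2 * real k * \<theta> = 2 * pi" using k by (simp add: \<theta>_def)
    show "A k = 0" "B k = 0" unfolding A_def B_def * by (simp_all add: cos_diff cos_add)
  qed
  ultimately show ?thesis by (metis (no_types, lifting) diff_zero ext mult_zero_left)
qed

section \<open>Homomorphisms out of a Coxeter group\<close>

lemma (in group) word_val_replicate:
  assumes "x \<in> carrier G" "y \<in> carrier G"
  shows "word_val G (concat (replicate k [(x, True), (y, True)])) = (x \<otimes> y) [^] k"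
proof (induction k)
  case (Suc k)
  have "(x \<otimes> y) [^] Suc k = (x \<otimes> y) \<otimes> (x \<otimes> y) [^] k"
    using assms by (intro nat_pow_Suc2) auto
  with Suc show ?case using assms by (simp add: m_assoc)
qed simp

lemma coxeter_system_relations:
  assumes "coxeter_system W S m"
  shows "s \<in> S \<Longrightarrow> s \<otimes>\<^bsub>W\<^esub> s = \<one>\<^bsub>W\<^esub>"
    and "s \<in> S \<Longrightarrow> t \<in> S \<Longrightarrow> s \<noteq> t \<Longrightarrow> m s t = enat k \<Longrightarrow> (s \<otimes>\<^bsub>W\<^esub> t) [^]\<^bsub>W\<^esub> k = \<one>\<^bsub>W\<^esub>"
proof -
  have pres: "presented_by W S (coxeter_relators S m)"
    using assms by (simp add: coxeter_system_def)
  interpret group W using pres by (simp add: presented_by_def)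
  have S: "S \<subseteq> carrier W" using pres by (simp add: presented_by_def)
  have rel: "word_val W r = \<one>\<^bsub>W\<^esub>" if "r \<in> coxeter_relators S m" for r
  proof -
    have "pres_eq S (coxeter_relators S m) r []"
      using pres_rel[OF that, of S "[]" "[]"] by simp
    then show ?thesis using pres that by (auto simp: presented_by_def)
  qed
  show "s \<otimes>\<^bsub>W\<^esub> s = \<one>\<^bsub>W\<^esub>" if "s \<in> S"
  proof -
    have "word_val W [(s, True), (s, True)] = \<one>\<^bsub>W\<^esub>"
      using that by (intro rel) (auto simp: coxeter_relators_def)
    then show ?thesis using that S by auto
  qed
  show "(s \<otimes>\<^bsub>W\<^esub> t) [^]\<^bsub>W\<^esub> k = \<one>\<^bsub>W\<^esub>" if "s \<in> S" "t \<in> S" "s \<noteq> t" "m s t = enat k"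
  proof -
    have "word_val W (concat (replicate k [(s, True), (t, True)])) = \<one>\<^bsub>W\<^esub>"
      using that by (intro rel) (auto simp: coxeter_relators_def)
    then show ?thesis using word_val_replicate[of s t k] that S by (metis subsetD)
  qed
qed

lemma coxeter_hom_exists:
  assumes W: "coxeter_system W S m" and "group H"
    and h: "\<And>s. s \<in> S \<Longrightarrow> h s \<in> carrier H" "\<And>s. s \<in> S \<Longrightarrow> h s \<otimes>\<^bsub>H\<^esub> h s = \<one>\<^bsub>H\<^esub>"
      "\<And>s t k. s \<in> S \<Longrightarrow> t \<in> S \<Longrightarrow> s \<noteq> t \<Longrightarrow> m s t = enat k \<Longrightarrow>
        (h s \<otimes>\<^bsub>H\<^esub> h t) [^]\<^bsub>H\<^esub> k = \<one>\<^bsub>H\<^esub>"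
  shows "\<exists>\<rho> \<in> hom W H. \<forall>s\<in>S. \<rho> s = h s"
proof (rule presented_by_hom_exists)
  interpret H: group H by fact
  show "presented_by W S (coxeter_relators S m)"
    using W by (simp add: coxeter_system_def)
  show "word_val H (map (apfst h) r) = \<one>\<^bsub>H\<^esub>" if "r \<in> coxeter_relators S m" for r
    using that unfolding coxeter_relators_def
    by (auto simp: map_concat h H.word_val_replicate)
qed (use assms in auto)

text \<open>Extensionality is vacuous on the whole type, so the restricted identity and composition
  become the ordinary ones.\<close>

lemma BijGroup_UNIV:
  shows carrier_BijGroup_UNIV: "carrier (BijGroup UNIV) = Bij UNIV"
    and one_BijGroup_UNIV: "\<one>\<^bsub>BijGroup UNIV\<^esub> = id"
    and mult_BijGroup_UNIV:
      "F \<in> Bij UNIV \<Longrightarrow> F' \<in> Bij UNIV \<Longrightarrow> F \<otimes>\<^bsub>BijGroup UNIV\<^esub> F' = F \<circ> F'"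
  by (auto simp: BijGroup_def compose_def fun_eq_iff)

lemma funpow_BijGroup_UNIV:
  fixes F :: "'a \<Rightarrow> 'a"
  assumes "F \<in> Bij UNIV"
  shows "F [^]\<^bsub>BijGroup UNIV\<^esub> (k::nat) = F ^^ k"
proof -
  interpret group "BijGroup (UNIV :: 'a set)" by (rule group_BijGroup)
  have F: "F \<in> carrier (BijGroup UNIV)" using assms by (simp only: carrier_BijGroup_UNIV)
  show ?thesis
  proof (induction k)
    case 0
    show ?case by (simp only: nat_pow_0 one_BijGroup_UNIV funpow.simps)
  next
    case (Suc k)
    have "F ^^ k \<in> Bij UNIV"
      using nat_pow_closed[OF F, of k] unfolding Suc carrier_BijGroup_UNIV .
    with Suc show ?case
      by (simp only: nat_pow_Suc funpow_Suc_right mult_BijGroup_UNIV assms)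
  qed
qed

lemma geometric_action_exists:
  assumes W: "coxeter_system W S m"
  shows "\<exists>act. coxeter_action W S m act \<and> (\<forall>s\<in>S. act s = geom_refl S m s)"
proof -
  let ?H = "BijGroup (UNIV :: ('a \<Rightarrow> real) set)"
  interpret H: group ?H by (rule group_BijGroup)
  have pres: "presented_by W S (coxeter_relators S m)" and fin: "finite S"
    and m: "\<And>s t. s \<in> S \<Longrightarrow> t \<in> S \<Longrightarrow> s \<noteq> t \<Longrightarrow> m s t = m t s"
      "\<And>s t. s \<in> S \<Longrightarrow> t \<in> S \<Longrightarrow> s \<noteq> t \<Longrightarrow> 2 \<le> m s t"
    using W by (auto simp: coxeter_system_def)
  interpret group W using pres by (simp add: presented_by_def)
  have S: "S \<subseteq> carrier W" and gen: "generate W S = carrier W"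
    using pres by (auto simp: presented_by_def)
  have bij: "geom_refl S m s \<in> Bij UNIV" for s
    unfolding Bij_def by (auto intro!: o_bij[of "geom_refl S m s"] simp: fun_eq_iff geom_refl_involution)
  note mult = mult_BijGroup_UNIV and one = one_BijGroup_UNIV and carrier = carrier_BijGroup_UNIV
  have "\<exists>\<rho> \<in> hom W ?H. \<forall>s\<in>S. \<rho> s = geom_refl S m s"
  proof (rule coxeter_hom_exists[OF W group_BijGroup])
    fix s t k assume st: "s \<in> S" "t \<in> S" "s \<noteq> t" "m s t = enat k"
    have "geom_refl S m s \<circ> geom_refl S m t \<in> Bij UNIV"
      using H.m_closed[of "geom_refl S m s" "geom_refl S m t"] bij by (simp add: mult carrier)
    moreover have "2 \<le> enat k" "m t s = enat k"
      using m[OF st(1-3)] st(4) by metis+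
    then have "2 \<le> k" "m t s = enat k" by (simp_all add: numeral_eq_enat)
    ultimately show "(geom_refl S m s \<otimes>\<^bsub>?H\<^esub> geom_refl S m t) [^]\<^bsub>?H\<^esub> k = \<one>\<^bsub>?H\<^esub>"
      using st fin by (simp add: mult[OF bij bij] funpow_BijGroup_UNIV one fun_eq_iff geom_refl_braid)
  qed (auto simp: carrier bij mult one fun_eq_iff geom_refl_involution)
  then obtain act where act: "act \<in> hom W ?H" "\<And>s. s \<in> S \<Longrightarrow> act s = geom_refl S m s"
    by auto
  interpret \<rho>: group_hom W ?H act
    using act by (simp add: group_hom_def group_hom_axioms_def group_axioms H.group_axioms)
  have act_bij: "act x \<in> Bij UNIV" if "x \<in> carrier W" for x
    using \<rho>.hom_closed[OF that] unfolding carrier .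
  have act_mult: "act (x \<otimes>\<^bsub>W\<^esub> y) = act x \<circ> act y" if "x \<in> carrier W" "y \<in> carrier W" for x y
    unfolding \<rho>.hom_mult[OF that] using that by (intro mult act_bij)
  have act_one: "act \<one>\<^bsub>W\<^esub> = id" unfolding \<rho>.hom_one one ..
  \<comment> \<open>The target group consists of all bijections, so linearity has to be carried from
    the generators to the whole group.\<close>
  have act_linear: "act x (\<lambda>r. a * u r + b * v r) = (\<lambda>r. a * act x u r + b * act x v r)"
    if "x \<in> carrier W" for x a b u v
  proof -
    from that have "x \<in> generate W S" by (simp add: gen)
    then show ?thesis
    proof (induction arbitrary: u v)
      case one
      then show ?case unfolding act_one by simp
    next
      case (incl s)
      then show ?case by (simp add: act geom_refl_linear)
    next
      case (inv s)
      then have "inv\<^bsub>W\<^esub> s = s"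
        using coxeter_system_relations(1)[OF W] S involution_inv by auto
      with inv show ?case by (simp add: act geom_refl_linear)
    next
      case (eng x y)
      then have "x \<in> carrier W" "y \<in> carrier W" by (simp_all only: gen)
      from act_mult[OF this] eng.IH show ?case by (simp only: o_apply)
    qed
  qed
  have "coxeter_action W S m act"
  proof unfold_locales
    show "act (x \<otimes>\<^bsub>W\<^esub> y) v = act x (act y v)" if "x \<in> carrier W" "y \<in> carrier W" for x y v
      unfolding act_mult[OF that] by simp
    show "act \<one>\<^bsub>W\<^esub> v = v" for v unfolding act_one by simp
    show "act s (simple_root s) = (\<lambda>r. - simple_root s r)" if "s \<in> S" for s
      unfolding act(2)[OF that] by (rule geom_refl_self)
    show "act s (simple_root t) = (\<lambda>r. simple_root t r + two_cos (m s t) * simple_root s r)"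
      if "s \<in> S" "t \<in> S" "s \<noteq> t" for s t
      unfolding act(2)[OF that(1)] using fin that(2,3) by (rule geom_refl_other)
  qed (fact S gen m act_linear coxeter_system_relations[OF W])+
  with act(2) show ?thesis by (intro exI[of _ act]) simp
qed

section \<open>Balanced weights are gradients\<close>

lemma awalk_append:
  fixes G :: "'a pair_pre_digraph"
  assumes "pre_digraph.awalk G u p v" "pre_digraph.awalk G v q w"
  shows "pre_digraph.awalk G u (p @ q) w"
proof -
  have "pcas u p v \<Longrightarrow> pcas v q w \<Longrightarrow> pcas u (p @ q) w" for u
    by (induction p arbitrary: u) auto
  with assms show ?thesis
    by (auto simp: pre_digraph.awalk_def cas_with_proj_eq)
qed

text \<open>Legality inverts the weight of each reversed arc.\<close>

lemma awalk_reverse: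
  fixes G :: "'a pair_pre_digraph"
  assumes sym: "\<And>a b. (a, b) \<in> parcs G \<Longrightarrow> (b, a) \<in> parcs G"
    and verts: "\<And>a b. (a, b) \<in> parcs G \<Longrightarrow> b \<in> pverts G"
    and f: "legal_weight G f" and p: "pre_digraph.awalk G u p v"
  shows "\<exists>q. pre_digraph.awalk G v q u \<and> path_weight f p * path_weight f q = 1"
  using p
proof (induction p arbitrary: u)
  case Nil
  then show ?case
    by (intro exI[of _ "[]"]) (auto simp: pre_digraph.awalk_def cas_with_proj_eq path_weight_def)
next
  case (Cons e p)
  obtain a b where e: "e = (a, b)" by (cases e)
  have ab: "a = u" "(u, b) \<in> parcs G" "pre_digraph.awalk G b p v" "u \<in> pverts G"
    using Cons.prems e verts by (auto simp: pre_digraph.awalk_def cas_with_proj_eq)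
  obtain q where q: "pre_digraph.awalk G v q b" "path_weight f p * path_weight f q = 1"
    using Cons.IH[OF ab(3)] by blast
  have "pre_digraph.awalk G b [(b, u)] u"
    using ab sym verts by (auto simp: pre_digraph.awalk_def cas_with_proj_eq)
  moreover have "f (u, b) * f (b, u) = 1"
    using f ab(2) sym[OF ab(2)] by (auto simp: legal_weight_def dest!: bspec)
  ultimately show ?case
    using awalk_append[OF q(1)] q(2) e ab(1)
    by (intro exI[of _ "q @ [(b, u)]"]) (simp add: path_weight_def algebra_simps)
qed

text \<open>The potential at a vertex is the weight of a path to a base point of its component;
  balance makes the choice of path immaterial.\<close>

lemma balanced_potential_exists:
  fixes G :: "'a pair_pre_digraph"
  assumes sym: "\<And>a b. (a, b) \<in> parcs G \<Longrightarrow> (b, a) \<in> parcs G"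
    and verts: "\<And>a b. (a, b) \<in> parcs G \<Longrightarrow> b \<in> pverts G"
    and f: "legal_weight G f" and bal: "balanced G f"
  shows "\<exists>g. (\<forall>a\<in>pverts G. g a \<noteq> 0) \<and> (\<forall>(a, b)\<in>parcs G. f (a, b) * g b = g a)"
proof -
  \<comment> \<open>\<open>C a\<close> is the component of \<open>a\<close>. Choosing the base point
    from this set makes adjacent vertices share it, as their components are equal sets.\<close>
  define C where "C a = {b. \<exists>p. pre_digraph.awalk G a p b}" for a
  define base where "base a = (SOME b. b \<in> C a)" for a
  define g where "g a = path_weight f (SOME p. pre_digraph.awalk G a p (base a))" for a
  have rev: "\<exists>q. pre_digraph.awalk G v q u \<and> path_weight f p * path_weight f q = 1"
    if "pre_digraph.awalk G u p v" for u p v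
    using sym verts f that by (rule awalk_reverse)
  have walk: "\<exists>p. pre_digraph.awalk G a p (base a) \<and> g a = path_weight f p" if "a \<in> pverts G" for a
  proof -
    have "pre_digraph.awalk G a [] a"
      using that by (simp add: pre_digraph.awalk_def cas_with_proj_eq)
    then have "a \<in> C a" by (auto simp: C_def)
    then have "base a \<in> C a" unfolding base_def by (rule someI[of "\<lambda>b. b \<in> C a"])
    then have "\<exists>p. pre_digraph.awalk G a p (base a)" by (simp add: C_def)
    from someI_ex[OF this] show ?thesis by (auto simp: g_def)
  qed
  have "f (a, b) * g b = g a" if ab: "(a, b) \<in> parcs G" for a b
  proof -
    have ba: "a \<in> pverts G" "b \<in> pverts G" using ab sym verts by auto
    have arc: "pre_digraph.awalk G a [(a, b)] b" "pre_digraph.awalk G b [(b, a)] a"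
      using ab sym ba by (auto simp: pre_digraph.awalk_def cas_with_proj_eq)
    have "C a = C b"
      unfolding C_def using awalk_append[OF arc(1)] awalk_append[OF arc(2)] by blast
    then have base: "base a = base b" by (simp add: base_def)
    obtain p where p: "pre_digraph.awalk G a p (base a)" "g a = path_weight f p"
      using walk[OF ba(1)] by auto
    obtain r where r: "pre_digraph.awalk G b r (base a)" "g b = path_weight f r"
      using walk[OF ba(2)] base by auto
    obtain q where q: "pre_digraph.awalk G (base a) q a" "path_weight f p * path_weight f q = 1"
      using rev[OF p(1)] by blast
    \<comment> \<open>The closed path from \<open>a\<close> over \<open>b\<close> and the base point
      back to \<open>a\<close> has weight \<open>f (a, b) * g b / g a\<close>.\<close>
    have "path_weight f ([(a, b)] @ r @ q) = 1"
      using bal awalk_append[OF arc(1) awalk_append[OF r(1) q(1)]]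
      unfolding balanced_def by blast
    then have "(f (a, b) * g b) * path_weight f q = g a * path_weight f q"
      using q(2) r(2) p(2) by (simp add: path_weight_def mult.assoc)
    moreover have "path_weight f q \<noteq> 0" using q(2) by auto
    ultimately show ?thesis by simp
  qed
  moreover have "g a \<noteq> 0" if a: "a \<in> pverts G" for a
  proof -
    obtain p where p: "pre_digraph.awalk G a p (base a)" "g a = path_weight f p"
      using walk[OF a] by auto
    show ?thesis using rev[OF p(1)] p(2) by auto
  qed
  ultimately show ?thesis by (intro exI[of _ g]) auto
qed

section \<open>Comparison of the weighted and the geometric representation\<close>

text \<open>The intertwining map: coordinates in the enumerated basis, multiplied by the diagonal
  matrix of the potential.\<close>

definition rescale :: "('a \<Rightarrow> complex) \<Rightarrow> nat \<Rightarrow> (nat \<Rightarrow> 'a) \<Rightarrow> ('a \<Rightarrow> real) \<Rightarrow> complex vec" where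
  "rescale g N s v = vec N (\<lambda>j. g (s j) * complex_of_real (v (s j)))"

lemma rescale_carrier [simp]: "rescale g N s v \<in> carrier_vec N"
  by (simp add: rescale_def)

lemma coxeter_omega_carrier [simp]: "coxeter_omega S m f N s i \<in> carrier_mat N N"
  by (simp add: coxeter_omega_def)

text \<open>In row \<open>i\<close> the potential turns each weight \<open>f (s i, s j)\<close>
  times \<open>g (s j)\<close> into the common factor \<open>g (s i)\<close>, which leaves the
  unweighted reflection.\<close>

lemma coxeter_omega_rescale:
  assumes W: "coxeter_system W S m" and bij: "bij_betw s {..<N} S" and i: "i < N"
    and g: "\<And>a b. {a, b} \<in> coxeter_edges S m \<Longrightarrow> f (a, b) * g b = g a"
  shows "coxeter_omega S m f N s i *\<^sub>v rescale g N s v = rescale g N s (geom_refl S m (s i) v)"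
proof (rule eq_vecI)
  fix k assume "k < dim_vec (rescale g N s (geom_refl S m (s i) v))"
  then have k: "k < N" by (simp add: rescale_def)
  have inj: "s j = s j' \<longleftrightarrow> j = j'" if "j < N" "j' < N" for j j'
    using bij that by (auto simp: bij_betw_def inj_on_def)
  have sS: "s j \<in> S" if "j < N" for j using bij that by (auto simp: bij_betw_def)
  have lhs: "(coxeter_omega S m f N s i *\<^sub>v rescale g N s v) $ k =
      (\<Sum>j<N. coxeter_omega S m f N s i $$ (k, j) * (g (s j) * complex_of_real (v (s j))))"
    using k by (simp add: coxeter_omega_def rescale_def scalar_prod_def atLeast0LessThan)
  show "(coxeter_omega S m f N s i *\<^sub>v rescale g N s v) $ k = rescale g N s (geom_refl S m (s i) v) $ k"
  proof (cases "k = i")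
    case False
    then have "(\<Sum>j<N. coxeter_omega S m f N s i $$ (k, j) * (g (s j) * complex_of_real (v (s j))))
        = (\<Sum>j<N. if j = k then g (s k) * complex_of_real (v (s k)) else 0)"
      using k by (intro sum.cong) (auto simp: coxeter_omega_def)
    then show ?thesis
      unfolding lhs using k False i by (simp add: rescale_def geom_refl_def simple_root_def inj)
  next
    case True
    have entry: "coxeter_omega S m f N s i $$ (i, j) * g (s j) = g (s i) * complex_of_real (two_cos (m (s i) (s j)))"
      if j: "j < N" "j \<noteq> i" for j
    proof (cases "{s i, s j} \<in> coxeter_edges S m")
      case True
      then show ?thesis using j i g[OF True] by (simp add: coxeter_omega_def algebra_simps)
    next
      case False
      have ne: "s i \<noteq> s j" using inj i j by auto
      \<comment> \<open>A missing edge means order 2, where \<open>two_cos\<close> vanishes, so the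
        zero entry fits the uniform formula.\<close>
      have "2 \<le> m (s i) (s j)" using W sS i j ne by (auto simp: coxeter_system_def)
      moreover have "\<not> 3 \<le> m (s i) (s j)"
        using False sS i j ne by (auto simp: coxeter_edges_def)
      ultimately have "m (s i) (s j) = enat 2"
        by (cases "m (s i) (s j)") (auto simp: numeral_eq_enat)
      then show ?thesis using j i False by (simp add: coxeter_omega_def two_cos_def)
    qed
    have "(\<Sum>j<N. coxeter_omega S m f N s i $$ (i, j) * (g (s j) * complex_of_real (v (s j)))) =
        - (g (s i) * v (s i)) + (\<Sum>j\<in>{..<N} - {i}. coxeter_omega S m f N s i $$ (i, j) * (g (s j) * complex_of_real (v (s j))))"
      using i by (subst sum.remove[of _ i]) (auto simp: coxeter_omega_def)
    also have "(\<Sum>j\<in>{..<N} - {i}. coxeter_omega S m f N s i $$ (i, j) * (g (s j) * complex_of_real (v (s j)))) =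
        (\<Sum>j\<in>{..<N} - {i}. g (s i) * complex_of_real (two_cos (m (s i) (s j)) * v (s j)))"
      by (rule sum.cong) (auto simp: entry simp flip: mult.assoc)
    also have "\<dots> = g (s i) * complex_of_real (\<Sum>j\<in>{..<N} - {i}. two_cos (m (s i) (s j)) * v (s j))"
      by (simp add: sum_distrib_left)
    also have "(\<Sum>j\<in>{..<N} - {i}. two_cos (m (s i) (s j)) * v (s j)) = (\<Sum>t\<in>S - {s i}. two_cos (m (s i) t) * v t)"
    proof (rule sum.reindex_bij_betw)
      show "bij_betw s ({..<N} - {i}) (S - {s i})"
        using bij_betw_DiffI[OF bij bij_betw_singletonI[of s i "s i"]] i sS by auto
    qed
    finally show ?thesis
      unfolding lhs unfolding True using i by (simp add: rescale_def geom_refl_def coroot_def simple_root_def algebra_simps)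
  qed
qed (simp add: rescale_def coxeter_omega_def)

text \<open>Rescaled simple roots are nonzero multiples of the unit vectors, so real arguments
  already determine a complex matrix.\<close>

lemma mat_eq_if_rescale_eq:
  assumes A: "A \<in> carrier_mat N N" and B: "B \<in> carrier_mat N N"
    and inj: "inj_on s {..<N}" and g: "\<And>j. j < N \<Longrightarrow> g (s j) \<noteq> 0"
    and eq: "\<And>v. A *\<^sub>v rescale g N s v = B *\<^sub>v rescale g N s v"
  shows "A = B"
proof (rule eq_matI)
  fix i j assume "i < dim_row B" "j < dim_col B"
  then have ij: "i < N" "j < N" using B by auto
  have "rescale g N s (simple_root (s j)) = g (s j) \<cdot>\<^sub>v unit_vec N j"
    using ij inj by (intro eq_vecI) (auto simp: rescale_def simple_root_def unit_vec_def inj_on_def)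
  moreover have "(M *\<^sub>v (g (s j) \<cdot>\<^sub>v unit_vec N j)) $ i = g (s j) * M $$ (i, j)"
    if "M \<in> carrier_mat N N" for M
    using that ij by simp
  ultimately have "g (s j) * A $$ (i, j) = g (s j) * B $$ (i, j)"
    using eq[of "simple_root (s j)"] A B by metis
  then show "A $$ (i, j) = B $$ (i, j)" using g ij by simp
qed (use A B in auto)

lemma group_GL: "group (GL N)"
proof -
  interpret ring "ring_mat TYPE(complex) N ()" by (rule ring_mat)
  show ?thesis unfolding GL_def by (rule units_group)
qed

lemma GL_simps: "x \<otimes>\<^bsub>GL N\<^esub> y = x * y" "\<one>\<^bsub>GL N\<^esub> = 1\<^sub>m N"
  by (simp_all add: GL_def units_of_def ring_mat_def)

lemma GL_carrier_mat: "x \<in> carrier (GL N) \<Longrightarrow> x \<in> carrier_mat N N"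
  by (auto simp: GL_def units_of_def ring_mat_def Units_def)

lemma involution_in_GL: "x \<in> carrier_mat N N \<Longrightarrow> x * x = 1\<^sub>m N \<Longrightarrow> x \<in> carrier (GL N)"
  by (auto simp: GL_def units_of_def ring_mat_def Units_def)

theorem proposition3p1:
  fixes W :: "('a, 'b) monoid_scheme"
    and S :: "'a set"
    and m :: "'a \<Rightarrow> 'a \<Rightarrow> enat"
    and f :: "'a \<times> 'a \<Rightarrow> complex"
    and N :: nat
    and s :: "nat \<Rightarrow> 'a"
  assumes "coxeter_system W S m"
    and "bij_betw s {..<N} S"
    and "legal_weight (coxeter_digraph S m) f"
    and "balanced (coxeter_digraph S m) f"
  shows "coxeter_rep W S m f N s \<in> hom W (GL N)
    \<and> (\<forall>i<N. coxeter_rep W S m f N s (s i) = coxeter_omega S m f N s i)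
    \<and> inj_on (coxeter_rep W S m f N s) (carrier W)"
proof -
  have pres: "presented_by W S (coxeter_relators S m)" and fin: "finite S"
    and m: "\<And>s t. s \<in> S \<Longrightarrow> t \<in> S \<Longrightarrow> s \<noteq> t \<Longrightarrow> m s t = m t s"
      "\<And>s t. s \<in> S \<Longrightarrow> t \<in> S \<Longrightarrow> s \<noteq> t \<Longrightarrow> 2 \<le> m s t"
    using assms(1) by (auto simp: coxeter_system_def)
  interpret W: group W using pres by (simp add: presented_by_def)
  interpret H: group "GL N" by (rule group_GL)
  have S: "S \<subseteq> carrier W" and gen: "generate W S = carrier W"
    using pres by (auto simp: presented_by_def)
  have inj: "inj_on s {..<N}" and img: "s ` {..<N} = S"
    using assms(2) by (auto simp: bij_betw_def)
  have sS: "s j \<in> S" if "j < N" for j using that img by auto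
  have "\<exists>g. (\<forall>a\<in>pverts (coxeter_digraph S m). g a \<noteq> 0) \<and>
      (\<forall>(a, b)\<in>parcs (coxeter_digraph S m). f (a, b) * g b = g a)"
    using assms(3,4) by (rule balanced_potential_exists[rotated 2])
      (auto simp: coxeter_digraph_def coxeter_edges_def insert_commute doubleton_eq_iff)
  then obtain g where g: "\<And>a. a \<in> S \<Longrightarrow> g a \<noteq> 0"
    "\<And>a b. {a, b} \<in> coxeter_edges S m \<Longrightarrow> f (a, b) * g b = g a"
    by (auto simp: coxeter_digraph_def)
  let ?\<Phi> = "rescale g N s" and ?\<omega> = "coxeter_omega S m f N s"
  have omega: "?\<omega> i *\<^sub>v ?\<Phi> v = ?\<Phi> (geom_refl S m (s i) v)" if "i < N" for i v
    by (rule coxeter_omega_rescale[OF assms(1,2) that]) (rule g(2))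
  have mat_eq: "A = B" if "A \<in> carrier_mat N N" "B \<in> carrier_mat N N"
    "\<And>v. A *\<^sub>v ?\<Phi> v = B *\<^sub>v ?\<Phi> v" for A B
    using mat_eq_if_rescale_eq[OF that(1,2) inj _ that(3)] g(1) sS by blast
  have omega_sq: "?\<omega> i * ?\<omega> i = 1\<^sub>m N" if "i < N" for i
  proof (rule mat_eq)
    fix v
    have "(?\<omega> i * ?\<omega> i) *\<^sub>v ?\<Phi> v = ?\<omega> i *\<^sub>v (?\<omega> i *\<^sub>v ?\<Phi> v)"
      by (rule assoc_mult_mat_vec[of _ N N _ N]) auto
    then show "(?\<omega> i * ?\<omega> i) *\<^sub>v ?\<Phi> v = 1\<^sub>m N *\<^sub>v ?\<Phi> v"
      by (simp add: omega that geom_refl_involution)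
  qed (auto intro: mult_carrier_mat[of _ N N])
  have omega_GL: "?\<omega> i \<in> carrier (GL N)" if "i < N" for i
    using omega_sq[OF that] by (simp add: involution_in_GL)
  \<comment> \<open>Matrices are indexed by positions, while the universal property asks for a map
    on \<open>S\<close>.\<close>
  define idx where "idx = the_inv_into {..<N} s"
  have idx: "idx a < N" "s (idx a) = a" if "a \<in> S" for a
    using that the_inv_into_into[OF inj, of a] f_the_inv_into_f[OF inj, of a] img
    by (auto simp: idx_def)
  have idx_s: "idx (s i) = i" if "i < N" for i
    using the_inv_into_f_f[OF inj] that by (simp add: idx_def)
  have "\<exists>\<rho> \<in> hom W (GL N). \<forall>a\<in>S. \<rho> a = ?\<omega> (idx a)"
  proof (rule coxeter_hom_exists[OF assms(1) group_GL])
    fix a b k assume ab: "a \<in> S" "b \<in> S" "a \<noteq> b" "m a b = enat k"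
    define M where "M = ?\<omega> (idx a) * ?\<omega> (idx b)"
    have M_GL: "M \<in> carrier (GL N)"
      using H.m_closed[OF omega_GL omega_GL] ab idx by (simp add: M_def GL_simps)
    have Mc: "M \<in> carrier_mat N N" using GL_carrier_mat[OF M_GL] .
    have M: "M *\<^sub>v ?\<Phi> v = ?\<Phi> ((geom_refl S m a \<circ> geom_refl S m b) v)" for v
    proof -
      have "M *\<^sub>v ?\<Phi> v = ?\<omega> (idx a) *\<^sub>v (?\<omega> (idx b) *\<^sub>v ?\<Phi> v)"
        unfolding M_def by (rule assoc_mult_mat_vec[of _ N N _ N]) auto
      then show ?thesis using ab idx by (simp add: omega)
    qed
    have pow: "(M [^]\<^bsub>GL N\<^esub> n) *\<^sub>v ?\<Phi> v = ?\<Phi> (((geom_refl S m a \<circ> geom_refl S m b) ^^ n) v)" for n v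
    proof (induction n arbitrary: v)
      case (Suc n)
      have "(M [^]\<^bsub>GL N\<^esub> n * M) *\<^sub>v ?\<Phi> v = M [^]\<^bsub>GL N\<^esub> n *\<^sub>v (M *\<^sub>v ?\<Phi> v)"
        using GL_carrier_mat[OF H.nat_pow_closed[OF M_GL]] Mc
        by (rule assoc_mult_mat_vec) simp
      then show ?case using Suc by (simp add: M GL_simps funpow_Suc_right del: funpow.simps)
    qed (simp add: GL_simps)
    have "2 \<le> enat k" "m b a = enat k"
      using m[OF ab(1-3)] ab(4) by metis+
    then have k: "2 \<le> k" "m b a = enat k" by (simp_all add: numeral_eq_enat)
    have "M [^]\<^bsub>GL N\<^esub> k = 1\<^sub>m N"
      using GL_carrier_mat[OF H.nat_pow_closed[OF M_GL]]
      by (rule mat_eq) (auto simp: pow geom_refl_braid fin ab k)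
    then show "(?\<omega> (idx a) \<otimes>\<^bsub>GL N\<^esub> ?\<omega> (idx b)) [^]\<^bsub>GL N\<^esub> k = \<one>\<^bsub>GL N\<^esub>"
      by (simp add: GL_simps M_def)
  qed (auto simp: omega_GL idx GL_simps omega_sq)
  then obtain \<rho>0 where \<rho>0: "\<rho>0 \<in> hom W (GL N)" "\<And>a. a \<in> S \<Longrightarrow> \<rho>0 a = ?\<omega> (idx a)"
    by auto
  \<comment> \<open>Restriction fixes the values outside the carrier, so uniqueness holds as
    equality of functions.\<close>
  define \<rho> where "\<rho> = restrict \<rho>0 (carrier W)"
  have \<rho>: "\<rho> \<in> hom W (GL N)" "\<rho> \<in> extensional (carrier W)" "\<forall>i<N. \<rho> (s i) = ?\<omega> i"
    using W.hom_restrict[OF \<rho>0(1), of \<rho>] \<rho>0(2) S sS idx_s by (auto simp: \<rho>_def)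
  have rep: "coxeter_rep W S m f N s = \<rho>"
    unfolding coxeter_rep_def
  proof (rule the_equality)
    fix \<sigma> assume \<sigma>: "\<sigma> \<in> hom W (GL N) \<and> \<sigma> \<in> extensional (carrier W) \<and> (\<forall>i<N. \<sigma> (s i) = ?\<omega> i)"
    show "\<sigma> = \<rho>"
    proof (rule extensionalityI)
      fix x assume "x \<in> carrier W"
      then have "x \<in> generate W S" by (simp add: gen)
      then show "\<sigma> x = \<rho> x"
        by (rule hom_eq_on_generate[OF W.group_axioms group_GL _ \<rho>(1) S, rotated 2])
          (use \<sigma> \<rho>(3) img in auto)
    qed (use \<sigma> \<rho> in auto)
  qed (use \<rho> in auto)
  interpret \<rho>: group_hom W "GL N" \<rho>
    using \<rho>(1) by (simp add: group_hom_def group_hom_axioms_def W.group_axioms group_GL)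
  obtain act where act: "coxeter_action W S m act" "\<And>a. a \<in> S \<Longrightarrow> act a = geom_refl S m a"
    using geometric_action_exists[OF assms(1)] by auto
  interpret act: coxeter_action W S m act by (rule act(1))
  have \<rho>_act: "\<rho> x *\<^sub>v ?\<Phi> v = ?\<Phi> (act x v)" if "x \<in> carrier W" for x v
  proof -
    have base: "\<rho> a *\<^sub>v ?\<Phi> v = ?\<Phi> (act a v)" if "a \<in> S" for a v
      using omega[OF idx(1)[OF that]] \<rho>(3) idx[OF that] act(2)[OF that] by metis
    from that have "x \<in> generate W S" by (simp add: gen)
    then show ?thesis
    proof (induction arbitrary: v)
      case one
      show ?case by (simp add: GL_simps act.act_one)
    next
      case (incl a)
      then show ?case by (rule base)
    next
      case (inv a)
      then have "inv\<^bsub>W\<^esub> a = a" using act.involution W.involution_inv by simp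
      with inv base show ?case by simp
    next
      case (eng x y)
      then have xy: "x \<in> carrier W" "y \<in> carrier W" by (simp_all add: gen)
      have "(\<rho> x * \<rho> y) *\<^sub>v ?\<Phi> v = \<rho> x *\<^sub>v (\<rho> y *\<^sub>v ?\<Phi> v)"
        using xy by (intro assoc_mult_mat_vec[of _ N N _ N]) (auto intro: GL_carrier_mat)
      then show ?case using eng xy by (simp add: GL_simps act.act_mult)
    qed
  qed
  have "x = \<one>\<^bsub>W\<^esub>" if x: "x \<in> carrier W" "\<rho> x = \<one>\<^bsub>GL N\<^esub>" for x
  proof (rule ccontr)
    assume "x \<noteq> \<one>\<^bsub>W\<^esub>"
    then obtain a where a: "a \<in> S" "act x (simple_root a) a \<le> 0"
      using act.exists_negative_root x(1) by auto
    \<comment> \<open>The two sides are compared at the coordinate of \<open>a\<close>: the simple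
      root has value 1 there and its image at most 0, while the factor \<open>g a\<close>
      cancels.\<close>
    have "?\<Phi> (act x (simple_root a)) = ?\<Phi> (simple_root a)"
      using \<rho>_act[OF x(1), of "simple_root a"] x(2) by (simp add: GL_simps)
    then have "?\<Phi> (act x (simple_root a)) $ idx a = ?\<Phi> (simple_root a) $ idx a"
      by simp
    then have "act x (simple_root a) a = simple_root a a"
      using a(1) idx g(1) by (simp add: rescale_def)
    with a(2) show False by (simp add: simple_root_def)
  qed
  then have "inj_on \<rho> (carrier W)"
    by (intro \<rho>.inj_on_one_iff[THEN iffD2]) auto
  with \<rho> rep show ?thesis by simp
qed

end
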